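(* For any $T_2$ (Hausdorff) topological space $X$ and any function $f\colon\omega\to\omega\setminus\{0\}$, the games $G_1(\mathcal{O},\mathcal{O})$ and $G_f(\mathcal{O},\mathcal{O})$ on $X$ are equivalent.
   Context: Let $\mathcal{O}$ denote the collection of all open covers of $X$. All games are two-player games of length $\omega$ with perfect information, with rounds $n=0,1,2,\dots$. The Rothberger game $G_1(\mathcal{O},\mathcal{O})$ on $X$: in round $n$, player I plays an open cover $\mathcal{U}_n\in\mathcal{O}$, and player II responds with a single set $U_n\in\mathcal{U}_n$. Player II wins the run iff $X=\bigcup_n U_n$; otherwise player I wins. The game $G_f(\mathcal{O},\mathcal{O})$ on $X$: in round $n$, player I plays an open cover $\mathcal{U}_n\in\mathcal{O}$, and player II responds by choosing $f(n)$ sets $U_n^0,\dots,U_n^{f(n)-1}$ from $\mathcal{U}_n$ (repetitions allowed). Player II wins the run iff $X=\bigcup_n\bigcup_{i<f(n)}U_n^i$; otherwise player I wins. Two games are equivalent if whenever one of the players has a winning strategy in one of the games, then that same player has a winning strategy in the other game. *)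

theory Defs
  imports "HOL-Analysis.Analysis"
begin

(* Two-player games of length omega with perfect information. In round n, player I makes
   a move m n from moves_I, and then player II answers with a move r n from moves_II n (m n).
   win_II m r says that player II wins the infinite run (m 0, r 0, m 1, r 1, ...). *)

record ('m, 'r) game =
  moves_I :: "'m set"
  moves_II :: "nat \<Rightarrow> 'm \<Rightarrow> 'r set"
  win_II :: "(nat \<Rightarrow> 'm) \<Rightarrow> (nat \<Rightarrow> 'r) \<Rightarrow> bool"

(* A strategy is a function of the opponent's moves so far. A round in which player II has
   no legal answer is lost for player II; in the games below, this can only happen on the
   empty space, when player I plays the empty cover. *)

definition strategy_I :: "('m, 'r) game \<Rightarrow> ('r list \<Rightarrow> 'm) \<Rightarrow> bool" where
  "strategy_I G \<sigma> \<longleftrightarrow> (\<forall>rs. \<sigma> rs \<in> moves_I G)"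

definition winning_strategy_I :: "('m, 'r) game \<Rightarrow> ('r list \<Rightarrow> 'm) \<Rightarrow> bool" where
  "winning_strategy_I G \<sigma> \<longleftrightarrow> strategy_I G \<sigma> \<and>
    (\<forall>r. (\<forall>n. r n \<in> moves_II G n (\<sigma> (map r [0..<n]))) \<longrightarrow>
      \<not> win_II G (\<lambda>n. \<sigma> (map r [0..<n])) r)"

definition strategy_II :: "('m, 'r) game \<Rightarrow> ('m list \<Rightarrow> 'r) \<Rightarrow> bool" where
  "strategy_II G \<tau> \<longleftrightarrow>
    (\<forall>ms m. set ms \<subseteq> moves_I G \<longrightarrow> m \<in> moves_I G \<longrightarrow>
      \<tau> (ms @ [m]) \<in> moves_II G (length ms) m)"

definition winning_strategy_II :: "('m, 'r) game \<Rightarrow> ('m list \<Rightarrow> 'r) \<Rightarrow> bool" where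
  "winning_strategy_II G \<tau> \<longleftrightarrow> strategy_II G \<tau> \<and>
    (\<forall>m. (\<forall>n. m n \<in> moves_I G) \<longrightarrow> win_II G m (\<lambda>n. \<tau> (map m [0..<Suc n])))"

definition equivalent_games :: "('m, 'r) game \<Rightarrow> ('k, 's) game \<Rightarrow> bool" where
  "equivalent_games G H \<longleftrightarrow>
    ((\<exists>\<sigma>. winning_strategy_I G \<sigma>) \<longleftrightarrow> (\<exists>\<sigma>. winning_strategy_I H \<sigma>)) \<and>
    ((\<exists>\<tau>. winning_strategy_II G \<tau>) \<longleftrightarrow> (\<exists>\<tau>. winning_strategy_II H \<tau>))"

definition open_covers :: "'a topology \<Rightarrow> 'a set set set" where
  "open_covers X = {\<U>. (\<forall>U\<in>\<U>. openin X U) \<and> \<Union>\<U> = topspace X}"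

definition Rothberger_game :: "'a topology \<Rightarrow> ('a set set, 'a set) game" where
  "Rothberger_game X =
    \<lparr>moves_I = open_covers X,
     moves_II = (\<lambda>n \<U>. \<U>),
     win_II = (\<lambda>\<U> U. topspace X = (\<Union>n. U n))\<rparr>"

(* The f n sets chosen in round n form a list of length f n. *)

definition f_Rothberger_game ::
  "(nat \<Rightarrow> nat) \<Rightarrow> 'a topology \<Rightarrow> ('a set set, 'a set list) game" where
  "f_Rothberger_game f X =
    \<lparr>moves_I = open_covers X,
     moves_II = (\<lambda>n \<U>. {Us. length Us = f n \<and> set Us \<subseteq> \<U>}),
     win_II = (\<lambda>\<U> U. topspace X = (\<Union>n. \<Union>i<f n. U n ! i))\<rparr>"

end

theory Submission
  imports Defs
begin

text \<open>
  For player I, a winning strategy in the Rothberger game refutes the selection principle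
  \<open>S\<^sub>1(\<O>,\<O>)\<close> by Pawlikowski's theorem; player I then wins the other game with predetermined
  covers, namely common refinements of \<open>f n\<close> members of a sequence of covers witnessing the failure.

  For player II, let \<open>\<tau>\<close> win the \<open>f\<close>-game and let \<open>K s\<close> be the intersection, over all covers \<open>m\<close>, of
  the closures of the unions of the answers to \<open>m\<close> at the position \<open>s\<close>. In a Hausdorff space, any
  \<open>f n + 1\<close> points admit a cover whose members have at most one of them in the closure, so \<open>K s\<close>
  is finite. If \<open>V\<close> is an open set containing \<open>K s\<close>, the Lindelof property gives countably many
  covers \<open>m\<close> such that every point outside \<open>V\<close> avoids the answer of \<open>\<tau>\<close> to some \<open>m\<close>. In the
  Rothberger game player II covers, point by point, the sets \<open>K s\<close> for all \<open>s\<close> in the countable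
  tree generated in this way; a point missed by this play would yield a branch of the tree on
  which \<open>\<tau>\<close> loses.
\<close>

section \<open>Recursion along histories, and the selection principle\<close>

lemma ex_history_recursion:
  fixes h :: "'b list \<Rightarrow> 'b"
  shows "\<exists>k. \<forall>n. k n = h (map k [0..<n])"
  by (rule dependent_wellorder_choice[where P = "\<lambda>k n r. r = h (map k [0..<n])"])
     (auto intro!: arg_cong[where f = h])

text \<open>This is \<open>S\<^sub>1(\<O>,\<O>)\<close>. The empty space fails it, because
  \<open>{}\<close> is among its covers; this matches the convention that player II loses a round
  without a legal answer.\<close>

definition Rothberger_space :: "'a topology \<Rightarrow> bool" where
  "Rothberger_space X \<longleftrightarrow>
    (\<forall>\<U>. (\<forall>n::nat. \<U> n \<in> open_covers X) \<longrightarrow>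
      (\<exists>V. (\<forall>n. V n \<in> \<U> n) \<and> topspace X = (\<Union>n. V n)))"

lemma open_coversI:
  assumes "\<And>U. U \<in> \<U> \<Longrightarrow> openin X U"
    and "\<And>x. x \<in> topspace X \<Longrightarrow> \<exists>U\<in>\<U>. x \<in> U"
  shows "\<U> \<in> open_covers X"
  using assms openin_subset unfolding open_covers_def by fast

lemma open_coversD:
  assumes "\<U> \<in> open_covers X"
  shows "U \<in> \<U> \<Longrightarrow> openin X U" and "x \<in> topspace X \<Longrightarrow> \<exists>U\<in>\<U>. x \<in> U"
  using assms unfolding open_covers_def by auto

lemma Rothberger_spaceE:
  assumes "Rothberger_space X" and "\<And>n::nat. \<U> n \<in> open_covers X"
  obtains V where "\<And>n. V n \<in> \<U> n" and "topspace X = (\<Union>n. V n)"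
  using assms unfolding Rothberger_space_def by blast

section \<open>Pawlikowski's theorem\<close>

lemma Rothberger_select_infinitely_often:
  assumes X: "Rothberger_space X"
    and op: "\<And>n U. U \<in> F n \<Longrightarrow> openin X U"
    and ne: "\<And>n. F n \<noteq> {}"
    and inf: "\<And>x. x \<in> topspace X \<Longrightarrow> infinite {n::nat. x \<in> \<Union>(F n)}"
  obtains V where "\<And>n. V n \<in> F n" and "topspace X \<subseteq> (\<Union>n. V n)"
proof -
  \<comment> \<open>A set selected from the \<open>n\<close>-th cover lies in members of \<open>n + 1\<close> different families, one of which
    has not been used for a smaller index.\<close>
  define \<V> where "\<V> n = {\<Inter>m\<in>J. G m | J G. finite J \<and> card J = Suc n \<and> (\<forall>m\<in>J. G m \<in> F m)}" for n
  have \<V>: "\<V> n \<in> open_covers X" for n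
  proof (rule open_coversI)
    fix U assume "U \<in> \<V> n"
    then obtain J G where "U = (\<Inter>m\<in>J. G m)" "finite J" "card J = Suc n" "\<forall>m\<in>J. G m \<in> F m"
      unfolding \<V>_def by blast
    then show "openin X U"
      using op by (auto intro!: openin_Inter)
  next
    fix x assume "x \<in> topspace X"
    then obtain J where J: "J \<subseteq> {n. x \<in> \<Union>(F n)}" "card J = Suc n" "finite J"
      using inf infinite_arbitrarily_large by metis
    then have "\<forall>m\<in>J. \<exists>U. U \<in> F m \<and> x \<in> U"
      by blast
    then obtain G where "\<forall>m\<in>J. G m \<in> F m \<and> x \<in> G m"
      by metis
    with J have "(\<Inter>m\<in>J. G m) \<in> \<V> n" "x \<in> (\<Inter>m\<in>J. G m)"
      unfolding \<V>_def by auto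
    then show "\<exists>U\<in>\<V> n. x \<in> U" ..
  qed
  obtain W where W: "\<And>n. W n \<in> \<V> n" "topspace X = (\<Union>n. W n)"
    by (rule Rothberger_spaceE[OF X, of \<V>]) (use \<V> in blast)+
  then have "\<forall>n. \<exists>J G. W n = (\<Inter>m\<in>J. G m) \<and> finite J \<and> card J = Suc n \<and> (\<forall>m\<in>J. G m \<in> F m)"
    unfolding \<V>_def by blast
  then obtain J G where JG: "\<And>n. W n = (\<Inter>m\<in>J n. G n m)" "\<And>n. finite (J n)"
      "\<And>n. card (J n) = Suc n" "\<And>n m. m \<in> J n \<Longrightarrow> G n m \<in> F m"
    by metis
  have "\<exists>p. \<forall>n. p n \<in> J n \<and> p n \<notin> p ` {..<n}"
  proof (rule dependent_wellorder_choice[where P = "\<lambda>p n r. r \<in> J n \<and> r \<notin> p ` {..<n}"])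
    fix n :: nat and p :: "nat \<Rightarrow> nat"
    have "card (p ` {..<n}) < card (J n)"
      using card_image_le[of "{..<n}" p] JG(3)[of n] by simp
    then have "\<not> J n \<subseteq> p ` {..<n}"
      using card_mono[of "p ` {..<n}" "J n"] by auto
    then show "\<exists>r. r \<in> J n \<and> r \<notin> p ` {..<n}"
      by blast
  qed (auto simp: image_iff)
  then obtain p where p: "\<And>n. p n \<in> J n" "\<And>n. p n \<notin> p ` {..<n}"
    by blast
  have inj: "inj p"
    by (rule injI) (metis imageI lessThan_iff linorder_neqE_nat p(2))
  \<comment> \<open>Families with index outside the range of \<open>p\<close> contribute an
    arbitrary member, so that every \<open>F m\<close> is answered.\<close>
  define V where "V m = (if m \<in> range p then G (inv p m) m else (SOME U. U \<in> F m))" for m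
  show thesis
  proof
    show "V m \<in> F m" for m
      using p(1) JG(4) ne inj by (auto simp: V_def some_in_eq)
    have WV: "W n \<subseteq> V (p n)" for n
      using p(1)[of n] inj by (auto simp: V_def JG(1))
    have "W n \<subseteq> (\<Union>n. V n)" for n
      using WV[of n] by fast
    then show "topspace X \<subseteq> (\<Union>n. V n)"
      unfolding W(2) by (rule UN_least)
  qed
qed

lemma Rothberger_monotone_strategy:
  fixes W :: "nat list \<Rightarrow> nat \<Rightarrow> 'a set"
  assumes X: "Rothberger_space X"
    and op: "\<And>s k. openin X (W s k)"
    and mono: "\<And>s j k. j \<le> k \<Longrightarrow> W s j \<subseteq> W s k"
    and cov: "\<And>s x. x \<in> topspace X \<Longrightarrow> \<exists>k. x \<in> W s k"
  obtains g where "\<And>x. x \<in> topspace X \<Longrightarrow> infinite {n. x \<in> W (map g [0..<n]) (g n)}"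
proof -
  \<comment> \<open>Covering every point for each \<open>N\<close> at a stage whose answer is at least \<open>N\<close> forces infinitely
    many such stages.\<close>
  define U where "U N s = (\<Union>i\<in>{i. i < length s \<and> N \<le> s ! i}. W (take i s) (s ! i))" for N s
  have U_open: "openin X (U N s)" for N s
    unfolding U_def using op by blast
  have U_append: "U N s \<subseteq> U N (s @ t)" for N s t
    unfolding U_def by (fastforce simp: nth_append)
  \<comment> \<open>Only the last answer may be raised: changing an earlier one would change the
    sets offered afterwards.\<close>
  have U_mono: "U N (s @ [j]) \<subseteq> U N (s @ [k])" if "j \<le> k" for N s j k
  proof
    fix x assume "x \<in> U N (s @ [j])"
    then obtain i where i: "i \<le> length s" "N \<le> (s @ [j]) ! i" "x \<in> W (take i s) ((s @ [j]) ! i)"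
      unfolding U_def by (auto simp: less_Suc_eq_le)
    have "(s @ [j]) ! i \<le> (s @ [k]) ! i"
      using that i(1) by (auto simp: nth_append)
    with i mono have "N \<le> (s @ [k]) ! i" "x \<in> W (take i (s @ [k])) ((s @ [k]) ! i)"
      by auto
    with i(1) show "x \<in> U N (s @ [k])"
      unfolding U_def by (auto simp: less_Suc_eq_le simp del: take_append)
  qed
  have U_cov: "\<exists>k. x \<in> U N (s @ [k])" if x: "x \<in> topspace X" for x N s
  proof -
    obtain k where "x \<in> W s k"
      using cov[OF x] ..
    then have "x \<in> W s (max N k)"
      using mono[of k "max N k"] by auto
    then show ?thesis
      unfolding U_def by (intro exI[of _ "max N k"] UN_I[of "length s"]) auto
  qed
  have U_nth: "U N (take i s @ [s ! i]) \<subseteq> U N (s @ t)" if "i < length s" for N i s t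
    using U_append[of N "take (Suc i) s" "drop (Suc i) s @ t"] that
    by (metis append.assoc append_take_drop_id take_Suc_conv_app_nth)
  define S where "S n k = {s. set s \<subseteq> {..<k} \<and> length s \<le> n}" for n k :: nat
  have S_fin: "finite (S n k)" for n k
    unfolding S_def by (rule finite_lists_length_le) simp
  \<comment> \<open>By monotonicity this is contained in \<open>U N (s @ [k])\<close> for all \<open>s\<close> of length \<open>n\<close>, since an entry
    of \<open>s\<close> that is at least \<open>k\<close> does no worse than \<open>k\<close>; the finite intersection keeps it open.\<close>
  define V where "V N n k = (\<Inter>s\<in>S n k. U N (s @ [k]))" for N n k
  have V_open: "openin X (V N n k)" for N n k
  proof -
    have "[] \<in> S n k"
      by (simp add: S_def)
    then show ?thesis
      unfolding V_def using S_fin U_open by (intro openin_Inter) auto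
  qed
  have VU: "V N n k \<subseteq> U N (s @ [k])" if "length s = n" for N n k s
  proof -
    define t where "t = takeWhile (\<lambda>j. j < k) s"
    have "t \<in> S n k"
      using that set_takeWhileD length_takeWhile_le unfolding t_def S_def by fastforce
    then have *: "V N n k \<subseteq> U N (t @ [k])"
      unfolding V_def by blast
    show ?thesis
    proof (cases "length t < length s")
      case True
      then have "k \<le> s ! length t"
        using nth_length_takeWhile[of "\<lambda>j. j < k" s] by (simp add: t_def)
      moreover have "t = take (length t) s"
        unfolding t_def by (metis takeWhile_eq_take length_takeWhile_le)
      ultimately show ?thesis
        using * U_mono U_nth[OF True] by (metis order_trans)
    next
      case False
      then have "t = s"
        unfolding t_def by (metis length_takeWhile_le linorder_not_le order.antisym takeWhile_eq_take take_all order_refl)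
      with * show ?thesis by simp
    qed
  qed
  have V_cov: "\<exists>k. x \<in> V N n k" if x: "x \<in> topspace X" for x N n
  proof -
    \<comment> \<open>One \<open>k\<close> has to serve all histories of length at most
      \<open>n\<close>. In the induction step, a history with an entry at least the old bound
      \<open>k0\<close> reduces to the shorter segment before that entry; only finitely many
      histories remain.\<close>
    have "\<exists>k. \<forall>s. length s \<le> n \<longrightarrow> x \<in> U N (s @ [k])"
    proof (induction n)
      case 0
      then show ?case using U_cov[OF x, of N "[]"] by auto
    next
      case (Suc n)
      then obtain k0 where k0: "\<And>s. length s \<le> n \<Longrightarrow> x \<in> U N (s @ [k0])"
        by blast
      obtain c where c: "\<And>s. x \<in> U N (s @ [c s])"
        using U_cov[OF x] by metis
      obtain k1 where k1: "\<forall>k\<in>insert k0 (c ` S (Suc n) k0). k \<le> k1"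
        using finite_nat_set_iff_bounded_le[of "insert k0 (c ` S (Suc n) k0)"] S_fin by auto
      have "x \<in> U N (s @ [k1])" if len: "length s \<le> Suc n" for s
      proof (cases "s \<in> S (Suc n) k0")
        case True
        then show ?thesis
          using c[of s] k1 U_mono[of "c s" k1] by blast
      next
        case False
        with len have "\<not> set s \<subseteq> {..<k0}"
          by (simp add: S_def)
        then obtain y where "y \<in> set s" "k0 \<le> y"
          by force
        then obtain i where i: "i < length s" "k0 \<le> s ! i"
          by (metis in_set_conv_nth)
        then have "length (take i s) \<le> n"
          using len by simp
        then have "x \<in> U N (take i s @ [k0])"
          by (rule k0)
        then show ?thesis
          using U_mono[OF i(2)] U_nth[OF i(1)] by blast
      qed
      then show ?case by blast
    qed
    then show ?thesis
      unfolding V_def S_def by blast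
  qed
  \<comment> \<open>Pairing splits the stages into infinitely many infinite blocks, and the stages
    of block \<open>N\<close> alone cover the space by sets \<open>V N\<close>; \<open>g\<close>
    below joins the answers of all blocks.\<close>
  have "\<forall>N. \<exists>c. topspace X = (\<Union>j. V N (prod_encode (N, j)) (c j))"
  proof
    fix N
    have V: "range (V N (prod_encode (N, j))) \<in> open_covers X" for j
      using V_open V_cov by (intro open_coversI) auto
    obtain A where A: "\<And>j. A j \<in> range (V N (prod_encode (N, j)))" "topspace X = (\<Union>j. A j)"
      by (rule Rothberger_spaceE[OF X, of "\<lambda>j. range (V N (prod_encode (N, j)))"]) (use V in blast)+
    have "\<forall>j. \<exists>k. A j = V N (prod_encode (N, j)) k"
      using A(1) by blast
    then obtain c where "\<forall>j. A j = V N (prod_encode (N, j)) (c j)"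
      by (rule choice[THEN exE])
    then have "topspace X = (\<Union>j. V N (prod_encode (N, j)) (c j))"
      using A(2) by simp
    then show "\<exists>c. topspace X = (\<Union>j. V N (prod_encode (N, j)) (c j))"
      by (rule exI[of _ c])
  qed
  then obtain c where c: "\<forall>N. topspace X = (\<Union>j. V N (prod_encode (N, j)) (c N j))"
    by (rule choice[THEN exE])
  define g where "g n = case_prod c (prod_decode n)" for n
  show thesis
  proof
    fix x assume x: "x \<in> topspace X"
    show "infinite {n. x \<in> W (map g [0..<n]) (g n)}"
    proof
      assume "finite {n. x \<in> W (map g [0..<n]) (g n)}"
      then obtain N where N: "\<And>n. x \<in> W (map g [0..<n]) (g n) \<Longrightarrow> g n < N"
        using finite_nat_set_iff_bounded[of "g ` {n. x \<in> W (map g [0..<n]) (g n)}"] by auto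
      obtain j where j: "x \<in> V N (prod_encode (N, j)) (c N j)"
        using x c by blast
      define n where "n = prod_encode (N, j)"
      have "x \<in> V N n (g n)"
        using j by (simp add: n_def g_def)
      then have "x \<in> U N (map g [0..<n] @ [g n])"
        using VU[of "map g [0..<n]" n N "g n"] by auto
      then have "x \<in> U N (map g [0..<Suc n])"
        by simp
      then obtain i where "i < Suc n" "N \<le> g i" "x \<in> W (map g [0..<i]) (g i)"
        unfolding U_def by (auto simp: take_map simp del: upt_Suc)
      with N show False
        by fastforce
    qed
  qed
qed

text \<open>First only bounds on the answers are played: a point of \<open>W ms k\<close> lies,
  after every history bounded by \<open>ms\<close>, in a set of index at most \<open>k\<close>. This
  is monotone in \<open>k\<close>, so some \<open>g\<close> puts each point into \<open>W\<close>
  infinitely often. A selection from the families \<open>F n\<close> then turns the bounds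
  \<open>g\<close> into answers.\<close>

theorem Pawlikowski:
  fixes U :: "nat list \<Rightarrow> nat \<Rightarrow> 'a set"
  assumes X: "Rothberger_space X"
    and op: "\<And>s k. openin X (U s k)"
    and cov: "\<And>s x. x \<in> topspace X \<Longrightarrow> \<exists>k. x \<in> U s k"
  obtains h where "topspace X = (\<Union>n. U (map h [0..<n]) (h n))"
proof -
  define B where "B ms = {s. list_all2 (\<le>) s ms}" for ms :: "nat list"
  have B_fin: "finite (B ms)" for ms
  proof (rule finite_subset)
    show "B ms \<subseteq> {s. set s \<subseteq> {..Max (set ms)} \<and> length s = length ms}"
      unfolding B_def
      by (auto simp: list_all2_conv_all_nth in_set_conv_nth)
         (metis List.finite_set Max_ge nth_mem order_trans)
  qed (simp add: finite_lists_length_eq)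
  \<comment> \<open>Over an empty \<open>B ms\<close> the intersections below would be
    \<open>UNIV\<close>, which need not be open.\<close>
  have B_ne: "ms \<in> B ms" for ms
    by (simp add: B_def list_all2_conv_all_nth)
  define W where "W ms k = (\<Inter>s\<in>B ms. \<Union>j\<le>k. U s j)" for ms k
  obtain g where g: "\<And>x. x \<in> topspace X \<Longrightarrow> infinite {n. x \<in> W (map g [0..<n]) (g n)}"
  proof (rule Rothberger_monotone_strategy[OF X, of W])
    show "openin X (W ms k)" for ms k
      unfolding W_def using B_fin B_ne[of ms] op by (intro openin_Inter) blast+
    show "W ms j \<subseteq> W ms k" if "j \<le> k" for ms j k
      unfolding W_def using that by (auto intro: order_trans)
    show "\<exists>k. x \<in> W ms k" if x: "x \<in> topspace X" for ms x
    proof -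
      obtain c where c: "\<And>s. x \<in> U s (c s)"
        using cov[OF x] by metis
      obtain k where "\<forall>i\<in>c ` B ms. i \<le> k"
        using finite_nat_set_iff_bounded_le[of "c ` B ms"] B_fin by auto
      with c show ?thesis
        unfolding W_def by blast
    qed
  qed blast
  \<comment> \<open>A member of \<open>F n\<close> answers all histories bounded by \<open>g\<close>
    at once, since the history that arises is known only after the selection.\<close>
  define F where "F n = {\<Inter>s\<in>B (map g [0..<n]). U s (h s) | h. \<forall>s. h s \<le> g n}" for n
  obtain V where V: "\<And>n. V n \<in> F n" "topspace X \<subseteq> (\<Union>n. V n)"
  proof (rule Rothberger_select_infinitely_often[OF X, of F])
    show "openin X A" if A: "A \<in> F n" for n A
    proof -
      obtain h where "A = (\<Inter>s\<in>B (map g [0..<n]). U s (h s))"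
        using A unfolding F_def by blast
      then show ?thesis
        using B_fin B_ne[of "map g [0..<n]"] op by (auto intro!: openin_Inter simp del: map_map)
    qed
    show "F n \<noteq> {}" for n
      unfolding F_def by auto
    have "W (map g [0..<n]) (g n) \<subseteq> \<Union>(F n)" for n
    proof
      fix x assume "x \<in> W (map g [0..<n]) (g n)"
      then have "\<forall>s. \<exists>j\<le>g n. s \<in> B (map g [0..<n]) \<longrightarrow> x \<in> U s j"
        unfolding W_def by blast
      then obtain h where "\<And>s. h s \<le> g n" "\<And>s. s \<in> B (map g [0..<n]) \<Longrightarrow> x \<in> U s (h s)"
        by metis
      then show "x \<in> \<Union>(F n)"
        unfolding F_def by blast
    qed
    then show "infinite {n. x \<in> \<Union>(F n)}" if "x \<in> topspace X" for x
      using g[OF that] by (rule_tac infinite_super) auto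
  qed blast
  from V(1) have "\<forall>n. \<exists>h. V n = (\<Inter>s\<in>B (map g [0..<n]). U s (h s)) \<and> (\<forall>s. h s \<le> g n)"
    unfolding F_def by blast
  then obtain h where h: "\<And>n. V n = (\<Inter>s\<in>B (map g [0..<n]). U s (h n s))" "\<And>n s. h n s \<le> g n"
    by metis
  \<comment> \<open>Following the selected answers keeps \<open>k\<close> below \<open>g\<close>, so
    each history met is among those in the intersection forming \<open>V n\<close>.\<close>
  obtain k where k: "\<And>n. k n = h n (map k [0..<n])"
    using ex_history_recursion[of "\<lambda>s. h (length s) s"] by auto
  have "k n \<le> g n" for n
    using k h(2) by metis
  then have "map k [0..<n] \<in> B (map g [0..<n])" for n
    by (simp add: B_def list_all2_conv_all_nth)
  then have VU: "V n \<subseteq> U (map k [0..<n]) (k n)" for n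
    using h(1)[of n] k[of n] by auto
  have "(\<Union>n. V n) \<subseteq> (\<Union>n. U (map k [0..<n]) (k n))"
    using VU by (rule UN_mono[OF order_refl])
  with V(2) have "topspace X \<subseteq> (\<Union>n. U (map k [0..<n]) (k n))"
    by (rule order_trans)
  moreover have "(\<Union>n. U (map k [0..<n]) (k n)) \<subseteq> topspace X"
    using openin_subset[OF op] by (rule UN_least)
  ultimately have "topspace X = (\<Union>n. U (map k [0..<n]) (k n))"
    by (rule equalityI)
  then show thesis
    by (rule that)
qed

text \<open>The selection principle applied to a constant sequence of covers yields a countable
  subcover \<open>E rs\<close> of each \<open>\<sigma> rs\<close>. Restricted to these, the answers
  of player II become indices, to which \<open>Pawlikowski\<close> applies.\<close>

corollary winning_strategy_I_imp_not_Rothberger_space: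
  assumes win: "winning_strategy_I (Rothberger_game X) \<sigma>"
  shows "\<not> Rothberger_space X"
proof
  assume X: "Rothberger_space X"
  have \<sigma>: "\<sigma> rs \<in> open_covers X" for rs
    using win by (simp add: winning_strategy_I_def strategy_I_def Rothberger_game_def)
  have "\<forall>rs. \<exists>E. (\<forall>k::nat. E k \<in> \<sigma> rs) \<and> topspace X = (\<Union>k. E k)"
    using Rothberger_spaceE[OF X, of "\<lambda>_. \<sigma> _"] \<sigma> by metis
  then obtain E where E: "\<And>rs (k::nat). E rs k \<in> \<sigma> rs" "\<And>rs. topspace X = (\<Union>k. E rs k)"
    by metis
  define P where "P = foldl (\<lambda>rs k. rs @ [E rs k]) []"
  have P: "P [] = []" "P (s @ [k]) = P s @ [E (P s) k]" for s k
    by (simp_all add: P_def)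
  obtain h where h: "topspace X = (\<Union>n. E (P (map h [0..<n])) (h n))"
  proof (rule Pawlikowski[OF X, of "\<lambda>s. E (P s)"])
    show "openin X (E (P s) k)" for s k
      using open_coversD(1) \<sigma> E(1) by blast
    show "\<exists>k. x \<in> E (P s) k" if "x \<in> topspace X" for s x
      using that E(2)[of "P s"] by blast
  qed blast
  define r where "r n = E (P (map h [0..<n])) (h n)" for n
  have "P (map h [0..<n]) = map r [0..<n]" for n
    by (induction n) (simp_all add: P r_def)
  then have "r n \<in> \<sigma> (map r [0..<n])" for n
    using E(1) by (simp add: r_def)
  then have "topspace X \<noteq> (\<Union>n. r n)"
    using win by (simp add: winning_strategy_I_def Rothberger_game_def)
  with h show False
    by (simp add: r_def)
qed

section \<open>Player I\<close>

lemma not_Rothberger_space_imp_winning_strategy_I: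
  assumes X: "\<not> Rothberger_space X" and f: "\<And>n. f n \<noteq> 0"
  shows "\<exists>\<sigma>. winning_strategy_I (f_Rothberger_game f X) \<sigma>"
proof (cases "topspace X = {}")
  case True
  \<comment> \<open>Player I wins at once by \<open>{}\<close>, from which
    \<open>f 0 \<noteq> 0\<close> sets cannot be chosen.\<close>
  then have "{} \<in> open_covers X"
    by (simp add: open_covers_def)
  moreover have "\<not> (length Us = f 0 \<and> set Us \<subseteq> {})" for Us :: "'a set list"
    using f[of 0] by auto
  ultimately have "winning_strategy_I (f_Rothberger_game f X) (\<lambda>_. {})"
    unfolding winning_strategy_I_def strategy_I_def f_Rothberger_game_def by fastforce
  then show ?thesis by blast
next
  case False
  obtain \<U> where \<U>: "\<And>n::nat. \<U> n \<in> open_covers X"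
    and no: "\<And>V. (\<And>n. V n \<in> \<U> n) \<Longrightarrow> topspace X \<noteq> (\<Union>n. V n)"
    using X unfolding Rothberger_space_def by blast
  have ne: "\<U> n \<noteq> {}" for n
    using open_coversD(2)[OF \<U>[of n]] False by blast
  \<comment> \<open>Round \<open>n\<close> refines the first \<open>f n\<close> covers of row
    \<open>n\<close>, so the \<open>f n\<close> sets chosen from \<open>\<V> n\<close> can be spread
    over different covers, one set for each.\<close>
  define \<V> where
    "\<V> n = {\<Inter>i<f n. A i | A. \<forall>i<f n. A i \<in> \<U> (prod_encode (n, i))}" for n
  have \<V>: "\<V> n \<in> open_covers X" for n
  proof (rule open_coversI)
    show "openin X U" if "U \<in> \<V> n" for U
      using that f[of n] open_coversD(1)[OF \<U>] unfolding \<V>_def by (auto intro!: openin_Inter)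
    fix x assume "x \<in> topspace X"
    then have "\<forall>i. \<exists>U\<in>\<U> (prod_encode (n, i)). x \<in> U"
      using open_coversD(2)[OF \<U>] by blast
    then obtain A where "\<And>i. A i \<in> \<U> (prod_encode (n, i)) \<and> x \<in> A i"
      by metis
    then show "\<exists>U\<in>\<V> n. x \<in> U"
      unfolding \<V>_def by blast
  qed
  have "topspace X \<noteq> (\<Union>n. \<Union>i<f n. r n ! i)"
    if r: "\<And>n. length (r n) = f n \<and> set (r n) \<subseteq> \<V> n" for r
  proof
    assume eq: "topspace X = (\<Union>n. \<Union>i<f n. r n ! i)"
    \<comment> \<open>For \<open>i\<close> beyond \<open>f n\<close> any member serves; one exists
      as the space is nonempty.\<close>
    have "\<exists>U\<in>\<U> (prod_encode (n, i)). i < f n \<longrightarrow> r n ! i \<subseteq> U" for n i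
    proof (cases "i < f n")
      case True
      then have "r n ! i \<in> \<V> n"
        using r[of n] nth_mem by fastforce
      then show ?thesis
        using True unfolding \<V>_def by blast
    qed (use ne in blast)
    then obtain B where B: "\<And>n i. B n i \<in> \<U> (prod_encode (n, i))"
      "\<And>n i. i < f n \<Longrightarrow> r n ! i \<subseteq> B n i"
      by metis
    define V where "V m = case_prod B (prod_decode m)" for m
    have V: "V m \<in> \<U> m" for m
      using B(1)[of "fst (prod_decode m)" "snd (prod_decode m)"]
      by (simp add: V_def case_prod_beta)
    have "r n ! i \<subseteq> V (prod_encode (n, i))" if "i < f n" for n i
      using B(2)[OF that] by (simp add: V_def)
    then have "topspace X \<subseteq> (\<Union>m. V m)"
      unfolding eq by fastforce
    moreover have "(\<Union>m. V m) \<subseteq> topspace X"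
      using openin_subset[OF open_coversD(1)[OF \<U> V]] by (rule UN_least)
    ultimately have "topspace X = (\<Union>m. V m)"
      by (rule equalityI)
    with no[of V] V show False
      by blast
  qed
  then have "winning_strategy_I (f_Rothberger_game f X) (\<lambda>rs. \<V> (length rs))"
    using \<V> by (auto simp: winning_strategy_I_def strategy_I_def f_Rothberger_game_def)
  then show ?thesis by blast
qed

text \<open>Player II may repeat a single set \<open>f n\<close> times, so \<open>\<sigma>\<close>
  can be played against the histories \<open>c rs\<close> of repeated sets.\<close>

lemma winning_strategy_I_f_Rothberger_imp_Rothberger:
  assumes win: "winning_strategy_I (f_Rothberger_game f X) \<sigma>" and f: "\<And>n. f n \<noteq> 0"
  shows "\<exists>\<sigma>. winning_strategy_I (Rothberger_game X) \<sigma>"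
proof -
  define c where "c rs = map (\<lambda>i. replicate (f i) (rs ! i)) [0..<length rs]" for rs :: "'a set list"
  have c: "c (map r [0..<n]) = map (\<lambda>n. replicate (f n) (r n)) [0..<n]" for r n
    by (simp add: c_def)
  have "topspace X \<noteq> (\<Union>n. r n)" if r: "\<And>n. r n \<in> \<sigma> (c (map r [0..<n]))" for r
  proof -
    define R where "R n = replicate (f n) (r n)" for n
    have "R n \<in> moves_II (f_Rothberger_game f X) n (\<sigma> (map R [0..<n]))" for n
      using r[of n] unfolding c R_def by (auto simp: f_Rothberger_game_def)
    then have "topspace X \<noteq> (\<Union>n. \<Union>i<f n. R n ! i)"
      using win by (simp add: winning_strategy_I_def f_Rothberger_game_def)
    moreover have "(\<Union>i<f n. R n ! i) = r n" for n
      using f[of n] by (auto simp: R_def)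
    ultimately show ?thesis
      by simp
  qed
  then have "winning_strategy_I (Rothberger_game X) (\<sigma> \<circ> c)"
    using win
    by (auto simp: winning_strategy_I_def strategy_I_def f_Rothberger_game_def Rothberger_game_def)
  then show ?thesis by blast
qed

section \<open>Player II\<close>

lemma winning_strategy_II_Rothberger_imp_f_Rothberger:
  assumes win: "winning_strategy_II (Rothberger_game X) \<tau>" and f: "\<And>n. f n \<noteq> 0"
  shows "\<exists>\<tau>. winning_strategy_II (f_Rothberger_game f X) \<tau>"
proof -
  \<comment> \<open>The list of covers includes the current one, so the round is
    \<open>length ms - 1\<close>.\<close>
  define \<tau>' where "\<tau>' ms = replicate (f (length ms - 1)) (\<tau> ms)" for ms
  have "(\<Union>i<f n. \<tau>' (map m [0..<Suc n]) ! i) = \<tau> (map m [0..<Suc n])" for m n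
    using f[of n] by (auto simp: \<tau>'_def)
  then have "winning_strategy_II (f_Rothberger_game f X) \<tau>'"
    using win unfolding winning_strategy_II_def strategy_II_def
    by (auto simp: f_Rothberger_game_def Rothberger_game_def \<tau>'_def simp del: upt_Suc)
  then show ?thesis by blast
qed

section \<open>Finiteness of intersections of closures in Hausdorff spaces\<close>

lemma Hausdorff_space_separating_cover:
  assumes X: "Hausdorff_space X" and F: "finite F" "F \<subseteq> topspace X"
  obtains \<U> where "\<U> \<in> open_covers X"
    and "\<And>U x y. U \<in> \<U> \<Longrightarrow> x \<in> F \<Longrightarrow> y \<in> F \<Longrightarrow>
      x \<in> X closure_of U \<Longrightarrow> y \<in> X closure_of U \<Longrightarrow> x = y"
proof -
  \<comment> \<open>The point \<open>z\<close> and the finite, hence compact, set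
    \<open>F - {z}\<close> have disjoint open neighbourhoods; the closure of the first misses
    \<open>F - {z}\<close>.\<close>
  have "\<exists>U. openin X U \<and> z \<in> U \<and> X closure_of U \<inter> F \<subseteq> {z}" if z: "z \<in> topspace X" for z
  proof -
    have "compactin X {z}" "compactin X (F - {z})" "disjnt {z} (F - {z})"
      using z F by (auto intro!: finite_imp_compactin)
    then obtain U V where UV: "openin X U" "openin X V" "{z} \<subseteq> U" "F - {z} \<subseteq> V" "disjnt U V"
      by (rule Hausdorff_space_compact_separation[OF X])
    then have "V \<inter> X closure_of U = {}"
      by (simp add: openin_Int_closure_of_eq_empty disjnt_def Int_commute)
    with UV show ?thesis
      by blast
  qed
  then obtain N where N: "\<And>z. z \<in> topspace X \<Longrightarrow> openin X (N z) \<and> z \<in> N z \<and> X closure_of N z \<inter> F \<subseteq> {z}"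
    by metis
  show thesis
  proof
    show "N ` topspace X \<in> open_covers X"
      using N by (intro open_coversI) auto
    show "x = y" if "U \<in> N ` topspace X" "x \<in> F" "y \<in> F" "x \<in> X closure_of U" "y \<in> X closure_of U"
      for U x y
      using that N by blast
  qed
qed

text \<open>Closure commutes with finite unions, so each of \<open>k + 1\<close> points of the
  intersection would lie in the closure of some member of \<open>T \<U>\<close>. For a separating
  \<open>\<U>\<close> these members differ, but there are at most \<open>k\<close> of them.\<close>

lemma finite_Inter_closures:
  assumes X: "Hausdorff_space X"
    and T: "\<And>m. m \<in> open_covers X \<Longrightarrow> length (T m) = k \<and> set (T m) \<subseteq> m"
  shows "finite (\<Inter>m\<in>open_covers X. X closure_of \<Union>(set (T m)))" (is "finite ?K")
proof (rule ccontr)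
  assume "infinite ?K"
  then obtain F where F: "F \<subseteq> ?K" "card F = Suc k" "finite F"
    using infinite_arbitrarily_large by metis
  have "topspace X \<in> {topspace X}" "{topspace X} \<in> open_covers X"
    by (auto simp: open_covers_def)
  then have "F \<subseteq> topspace X"
    using F(1) closure_of_subset_topspace by fastforce
  then obtain \<U> where \<U>: "\<U> \<in> open_covers X"
    and sep: "\<And>U x y. U \<in> \<U> \<Longrightarrow> x \<in> F \<Longrightarrow> y \<in> F \<Longrightarrow>
      x \<in> X closure_of U \<Longrightarrow> y \<in> X closure_of U \<Longrightarrow> x = y"
    using Hausdorff_space_separating_cover[OF X F(3)] by metis
  have "\<exists>U\<in>set (T \<U>). x \<in> X closure_of U" if "x \<in> F" for x
  proof -
    have "x \<in> X closure_of \<Union>(set (T \<U>))"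
      using F(1) that \<U> by blast
    then show ?thesis
      by (simp add: closure_of_Union)
  qed
  then obtain c where c: "\<And>x. x \<in> F \<Longrightarrow> c x \<in> set (T \<U>) \<and> x \<in> X closure_of c x"
    by metis
  have "inj_on c F"
    using c sep T[OF \<U>] by (metis inj_onI subsetD)
  moreover have "c ` F \<subseteq> set (T \<U>)"
    using c by blast
  ultimately have "card F \<le> card (set (T \<U>))"
    by (metis List.finite_set card_image card_mono)
  also have "\<dots> \<le> k"
    using T[OF \<U>] card_length by metis
  finally show False
    using F(2) by simp
qed

section \<open>The Lindelof property and its use for choosing countably many covers\<close>

lemma winning_strategy_II_f_RothbergerD:
  assumes "winning_strategy_II (f_Rothberger_game f X) \<tau>"
  shows "set s \<subseteq> open_covers X \<Longrightarrow> u \<in> open_covers X \<Longrightarrow>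
      length (\<tau> (s @ [u])) = f (length s) \<and> set (\<tau> (s @ [u])) \<subseteq> u"
    and "(\<And>n. m n \<in> open_covers X) \<Longrightarrow> topspace X = (\<Union>n. \<Union>i<f n. \<tau> (map m [0..<Suc n]) ! i)"
  using assms unfolding winning_strategy_II_def strategy_II_def f_Rothberger_game_def by auto

text \<open>When player I plays the same cover in every round, the sets chosen by
  \<open>\<tau>\<close> form a countable subcover.\<close>

lemma winning_strategy_II_imp_Lindelof_space:
  assumes win: "winning_strategy_II (f_Rothberger_game f X) \<tau>"
  shows "Lindelof_space X"
  unfolding Lindelof_space_def
proof (intro allI impI, elim conjE)
  fix \<U> assume op: "\<forall>U\<in>\<U>. openin X U" and cov: "\<Union>\<U> = topspace X"
  then have \<U>: "\<U> \<in> open_covers X"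
    by (simp add: open_covers_def)
  define r where "r n = \<tau> (map (\<lambda>_. \<U>) [0..<Suc n])" for n
  have r: "length (r n) = f n \<and> set (r n) \<subseteq> \<U>" for n
    using winning_strategy_II_f_RothbergerD(1)[OF win, of "map (\<lambda>_. \<U>) [0..<n]" \<U>] \<U>
    by (auto simp: r_def)
  have "topspace X = (\<Union>n. \<Union>i<f n. r n ! i)"
    unfolding r_def using winning_strategy_II_f_RothbergerD(2)[OF win, of "\<lambda>_. \<U>"] \<U> .
  also have "\<dots> \<subseteq> \<Union>(\<Union>n. set (r n))"
    using r by (intro UN_least) (metis UN_I UNIV_I Union_upper lessThan_iff nth_mem)
  finally have "topspace X \<subseteq> \<Union>(\<Union>n. set (r n))" .
  moreover have sub: "(\<Union>n. set (r n)) \<subseteq> \<U>"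
    using r by (intro UN_least) simp
  ultimately have "\<Union>(\<Union>n. set (r n)) = topspace X"
    using Union_mono[OF sub] cov by simp
  moreover have "countable (\<Union>n. set (r n))"
    by (intro countable_UN) (auto intro: countable_finite)
  ultimately show "\<exists>\<V>. countable \<V> \<and> \<V> \<subseteq> \<U> \<and> \<Union>\<V> = topspace X"
    using sub by (intro exI[of _ "\<Union>n. set (r n)"] conjI)
qed

text \<open>The set \<open>V\<close> and the complements of the \<open>C m\<close> cover the space,
  and a countable subcover involves only countably many indices.\<close>

lemma Lindelof_space_closed_Inter_subset_open:
  assumes X: "Lindelof_space X" and V: "openin X V" and I: "I \<noteq> {}"
    and C: "\<And>m. m \<in> I \<Longrightarrow> closedin X (C m)" and sub: "(\<Inter>m\<in>I. C m) \<subseteq> V"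
  obtains e :: "nat \<Rightarrow> 'i" where "\<And>k. e k \<in> I" and "\<And>x. x \<in> topspace X - V \<Longrightarrow> \<exists>k. x \<notin> C (e k)"
proof -
  define \<U> where "\<U> = insert V ((\<lambda>m. topspace X - C m) ` I)"
  have op: "openin X U" if "U \<in> \<U>" for U
    using that V C unfolding \<U>_def by auto
  have "\<Union>\<U> = topspace X"
  proof
    show "\<Union>\<U> \<subseteq> topspace X"
      using openin_subset[OF op] by (rule Union_least)
    show "topspace X \<subseteq> \<Union>\<U>"
      using sub unfolding \<U>_def by auto
  qed
  then obtain \<V> where \<V>: "countable \<V>" "\<V> \<subseteq> \<U>" "\<Union>\<V> = topspace X"
    using Lindelof_spaceD[of X \<U>] X op by metis
  have "\<V> - {V} \<subseteq> (\<lambda>m. topspace X - C m) ` I"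
    using \<V>(2) unfolding \<U>_def by blast
  then obtain M where M: "M \<subseteq> I" "countable M" "\<V> - {V} = (\<lambda>m. topspace X - C m) ` M"
    using \<V>(1) countable_subset_image[of "\<V> - {V}"] by (metis countable_Diff)
  \<comment> \<open>\<open>M\<close> may be empty; adding \<open>a\<close> allows an enumeration by
    all natural numbers.\<close>
  obtain a where a: "a \<in> I"
    using I by blast
  define e where "e = from_nat_into (insert a M)"
  have e: "range e = insert a M"
    unfolding e_def using M(2) by (intro range_from_nat_into) auto
  show thesis
  proof
    show "e k \<in> I" for k
      using rangeI[of e k] M(1) a unfolding e by blast
    fix x assume x: "x \<in> topspace X - V"
    then obtain U where "U \<in> \<V> - {V}" "x \<in> U"
      using \<V>(3) by blast
    then obtain m where "m \<in> M" "x \<notin> C m"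
      unfolding M(3) by blast
    moreover from this have "m \<in> range e"
      by (simp add: e)
    ultimately show "\<exists>k. x \<notin> C (e k)"
      by blast
  qed
qed

text \<open>
  The nodes of a tree with root \<open>s0\<close> are treated one per round. The \<open>k\<close>-th child of the node of
  round \<open>n\<close> comes in round \<open>prod_encode (n, k) + 1 > n\<close>, so it may depend on the set chosen in round \<open>n\<close>.
\<close>

lemma strategy_II_visiting_tree:
  fixes pt :: "'s \<Rightarrow> 'a" and nxt :: "'s \<Rightarrow> 'a set \<Rightarrow> nat \<Rightarrow> 's"
  assumes pt: "\<And>s. pt s \<in> topspace X"
  shows "\<exists>\<tau>. strategy_II (Rothberger_game X) \<tau> \<and>
    (\<forall>m. (\<forall>n. m n \<in> open_covers X) \<longrightarrow> (\<exists>S. S 0 = s0 \<and>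
      (\<forall>n. pt (S n) \<in> \<tau> (map m [0..<Suc n]) \<and>
        (\<forall>k. \<exists>n'. S n' = nxt (S n) (\<tau> (map m [0..<Suc n])) k))))"
proof -
  define pick where "pick u x = (SOME U. U \<in> u \<and> x \<in> U)" for u :: "'a set set" and x
  have pick: "pick u x \<in> u \<and> x \<in> pick u x" if "u \<in> open_covers X" "x \<in> topspace X" for u x
    unfolding pick_def by (rule someI_ex) (use open_coversD(2)[OF that] in blast)
  \<comment> \<open>\<open>L\<close> holds the state and the chosen set of each past round, so
    \<open>length L\<close> is the current round; \<open>prod_decode\<close> recovers the round of
    the parent and the number of the child.\<close>
  define st where "st L = (case length L of 0 \<Rightarrow> s0
    | Suc q \<Rightarrow> (case prod_decode q of (p, k) \<Rightarrow> nxt (fst (L ! p)) (snd (L ! p)) k))"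
    for L :: "('s \<times> 'a set) list"
  \<comment> \<open>A strategy sees only the covers; \<open>H\<close> replays them to recover the
    states and the earlier answers.\<close>
  define H where "H = foldl (\<lambda>L u. L @ [(st L, pick u (pt (st L)))]) []"
  define \<tau> where "\<tau> ms = snd (last (H ms))" for ms
  have H: "H [] = []" "H (ms @ [u]) = H ms @ [(st (H ms), pick u (pt (st (H ms))))]" for ms u
    by (simp_all add: H_def)
  have \<tau>: "\<tau> (ms @ [u]) = pick u (pt (st (H ms)))" for ms u
    by (simp add: \<tau>_def H)
  show ?thesis
  proof (intro exI[of _ \<tau>] conjI allI impI)
    show "strategy_II (Rothberger_game X) \<tau>"
      using pick pt by (simp add: strategy_II_def Rothberger_game_def \<tau>)
    fix m assume m: "\<forall>n::nat. m n \<in> open_covers X"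
    define S where "S n = st (H (map m [0..<n]))" for n
    define A where "A n = \<tau> (map m [0..<Suc n])" for n
    have A: "A n = pick (m n) (pt (S n))" for n
      by (simp add: A_def S_def \<tau>)
    have HS: "H (map m [0..<n]) = map (\<lambda>n. (S n, A n)) [0..<n]" for n
      by (induction n) (simp_all add: H A S_def)
    have "S 0 = s0"
      by (simp add: S_def H st_def)
    moreover have "pt (S n) \<in> A n" for n
      using pick m pt by (simp add: A)
    moreover have "S (Suc (prod_encode (n, k))) = nxt (S n) (A n) k" for n k
    proof -
      have "n < Suc (prod_encode (n, k))"
        using le_prod_encode_1[of n k] by simp
      then have "map (\<lambda>n. (S n, A n)) [0..<Suc (prod_encode (n, k))] ! n = (S n, A n)"
        by (simp del: upt_Suc)
      then show ?thesis
        unfolding S_def[of "Suc (prod_encode (n, k))"] HS st_def by (simp del: upt_Suc)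
    qed
    ultimately show "\<exists>S. S 0 = s0 \<and>
      (\<forall>n. pt (S n) \<in> \<tau> (map m [0..<Suc n]) \<and>
        (\<forall>k. \<exists>n'. S n' = nxt (S n) (\<tau> (map m [0..<Suc n])) k))"
      unfolding A_def by blast
  qed
qed

lemma winning_strategy_II_f_Rothberger_imp_Rothberger:
  assumes X: "Hausdorff_space X" and f: "\<And>n. f n \<noteq> 0"
    and win: "winning_strategy_II (f_Rothberger_game f X) \<tau>"
  shows "\<exists>\<tau>. winning_strategy_II (Rothberger_game X) \<tau>"
proof -
  let ?O = "open_covers X"
  note \<tau> = winning_strategy_II_f_RothbergerD(1)[OF win]
    and \<tau>_win = winning_strategy_II_f_RothbergerD(2)[OF win]
  have O_ne: "?O \<noteq> {}"
    by (auto simp: open_covers_def intro!: exI[of _ "{topspace X}"])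
  \<comment> \<open>On the empty space no \<open>\<tau>\<close> could answer the cover
    \<open>{}\<close>.\<close>
  have "topspace X \<noteq> {}"
  proof
    assume "topspace X = {}"
    then have "{} \<in> ?O"
      by (simp add: open_covers_def)
    then show False
      using \<tau>[of "[]" "{}"] f[of 0] by auto
  qed
  then obtain x0 where x0: "x0 \<in> topspace X"
    by blast
  define C where "C s = X closure_of \<Union>(set (\<tau> s))" for s
  define K where "K s = (\<Inter>m\<in>?O. C (s @ [m]))" for s
  \<comment> \<open>Including \<open>x0\<close> keeps the list nonempty even if \<open>K s\<close>
    is empty, so every state has a point to cover.\<close>
  have "\<exists>xs. xs \<noteq> [] \<and> set xs \<subseteq> topspace X \<and> (set s \<subseteq> ?O \<longrightarrow> K s \<subseteq> set xs)" for s
  proof (cases "set s \<subseteq> ?O")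
    case True
    have "K s \<subseteq> topspace X"
      using O_ne closure_of_subset_topspace unfolding K_def C_def by fast
    moreover have "finite (K s)"
      unfolding K_def C_def using \<tau> True by (intro finite_Inter_closures[OF X]) auto
    then obtain xs where "set xs = K s"
      using finite_list by blast
    ultimately show ?thesis
      using x0 by (intro exI[of _ "x0 # xs"]) auto
  qed (use x0 in \<open>auto intro: exI[of _ "[x0]"]\<close>)
  then obtain \<kappa> where \<kappa>: "\<And>s. \<kappa> s \<noteq> []" "\<And>s. set (\<kappa> s) \<subseteq> topspace X"
      "\<And>s. set s \<subseteq> ?O \<Longrightarrow> K s \<subseteq> set (\<kappa> s)"
    by metis
  define E where "E s V e \<longleftrightarrow> (openin X V \<and> K s \<subseteq> V \<longrightarrow>
      (\<forall>k. e k \<in> ?O) \<and> (\<forall>x\<in>topspace X - V. \<exists>k. x \<notin> C (s @ [e k])))"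
    for s V and e :: "nat \<Rightarrow> 'a set set"
  have "\<exists>e. E s V e" for s V
  proof (cases "openin X V \<and> K s \<subseteq> V")
    case True
    then obtain e :: "nat \<Rightarrow> 'a set set" where
      "\<And>k. e k \<in> ?O" "\<And>x. x \<in> topspace X - V \<Longrightarrow> \<exists>k. x \<notin> C (s @ [e k])"
      using Lindelof_space_closed_Inter_subset_open[OF winning_strategy_II_imp_Lindelof_space[OF win],
          of V ?O "\<lambda>m. C (s @ [m])"] O_ne
      unfolding K_def C_def by (metis closedin_closure_of)
    then have "E s V e"
      by (simp add: E_def)
    then show ?thesis
      by blast
  qed (auto simp: E_def)
  then obtain e where "\<And>s V. E s V (e s V)"
    by metis
  then have e: "\<And>s V k. openin X V \<Longrightarrow> K s \<subseteq> V \<Longrightarrow> e s V k \<in> ?O"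
       "\<And>s V x. openin X V \<Longrightarrow> K s \<subseteq> V \<Longrightarrow> x \<in> topspace X - V \<Longrightarrow> \<exists>k. x \<notin> C (s @ [e s V k])"
    unfolding E_def by blast+
  \<comment> \<open>In a state \<open>(s, xs, V)\<close>, the points \<open>xs\<close> of \<open>K s\<close> are still to be covered, and \<open>V\<close> is the union
    of the sets chosen for the others.\<close>
  define pt where "pt = (\<lambda>(s :: 'a set set list, xs, V :: 'a set).
    if hd xs \<in> topspace X then hd xs else x0)"
  \<comment> \<open>The number \<open>k\<close> matters only once the last point is covered; before
    that all children coincide.\<close>
  define nxt where "nxt = (\<lambda>(s, xs, V) A k. if tl xs = []
    then (s @ [e s (V \<union> A) k], \<kappa> (s @ [e s (V \<union> A) k]), {}) else (s, tl xs, V \<union> A))"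
  have pt: "pt q \<in> topspace X" for q
    using x0 by (simp add: pt_def split: prod.split)
  obtain \<rho> where \<rho>: "strategy_II (Rothberger_game X) \<rho>"
    and visit: "\<forall>u. (\<forall>n. u n \<in> ?O) \<longrightarrow> (\<exists>S. S 0 = ([], \<kappa> [], {}) \<and>
      (\<forall>n. pt (S n) \<in> \<rho> (map u [0..<Suc n]) \<and>
        (\<forall>k. \<exists>n'. S n' = nxt (S n) (\<rho> (map u [0..<Suc n])) k)))"
    using strategy_II_visiting_tree[of pt X "([], \<kappa> [], {})" nxt, OF pt] by (elim exE conjE)
  have "topspace X = (\<Union>n. \<rho> (map u [0..<Suc n]))" if u: "\<And>n::nat. u n \<in> ?O" for u
  proof
    define A where "A n = \<rho> (map u [0..<Suc n])" for n
    have A_open: "openin X (A n)" for n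
    proof -
      have "\<rho> (map u [0..<n] @ [u n]) \<in> u n"
        using \<rho> u by (simp add: strategy_II_def Rothberger_game_def image_subset_iff)
      then show ?thesis
        using open_coversD(1)[OF u] by (simp add: A_def)
    qed
    show "(\<Union>n. \<rho> (map u [0..<Suc n])) \<subseteq> topspace X"
      using openin_subset[OF A_open] unfolding A_def by (rule UN_least)
    obtain S where S0: "S 0 = ([], \<kappa> [], {})" and S_pt: "\<And>n. pt (S n) \<in> A n"
      and S_nxt: "\<And>n k. \<exists>n'. S n' = nxt (S n) (A n) k"
      using visit[rule_format, of u] u unfolding A_def by metis
    show "topspace X \<subseteq> (\<Union>n. \<rho> (map u [0..<Suc n]))"
    proof (rule ccontr)
      assume "\<not> ?thesis"
      then obtain x where x: "x \<in> topspace X" and xA: "\<And>n. x \<notin> A n"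
        unfolding A_def by blast
      \<comment> \<open>Induction over the points still to be covered: \<open>x\<close> stays
        outside \<open>V\<close>, so after the last point some child position has an answer whose
        closure omits \<open>x\<close>.\<close>
      have step: "\<exists>m\<in>?O. x \<notin> C (s @ [m]) \<and> (\<exists>n. S n = (s @ [m], \<kappa> (s @ [m]), {}))"
        if "S n = (s, xs, V)" "xs \<noteq> []" "set xs \<subseteq> topspace X" "openin X V" "x \<notin> V"
          "K s \<subseteq> V \<union> set xs" for n s xs V
        using that(2,1,3-)
      proof (induction xs arbitrary: n V rule: list_nonempty_induct)
        case (single y)
        have "y \<in> A n"
          using S_pt[of n] single by (simp add: pt_def)
        then have V: "openin X (V \<union> A n)" "K s \<subseteq> V \<union> A n"
          using single A_open by auto
        moreover have "x \<in> topspace X - (V \<union> A n)"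
          using x xA single by blast
        ultimately obtain k where k: "x \<notin> C (s @ [e s (V \<union> A n) k])"
          using e(2) by blast
        have "\<exists>n'. S n' = (s @ [e s (V \<union> A n) k], \<kappa> (s @ [e s (V \<union> A n) k]), {})"
          using S_nxt[of n k] single by (simp add: nxt_def)
        with k e(1)[OF V, of k] show ?case
          by blast
      next
        case (cons y ys)
        have "y \<in> A n"
          using S_pt[of n] cons.prems by (simp add: pt_def)
        then have "openin X (V \<union> A n)" "K s \<subseteq> (V \<union> A n) \<union> set ys"
          using cons.prems A_open by auto
        moreover obtain n' where "S n' = (s, ys, V \<union> A n)"
          using S_nxt[of n 0] cons.prems cons.hyps by (auto simp: nxt_def)
        moreover have "x \<notin> V \<union> A n"
          using xA cons.prems by blast
        ultimately show ?case
          using cons.prems by (intro cons.IH[of n' "V \<union> A n"]) auto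
      qed
      \<comment> \<open>\<open>Q\<close> marks the legal positions whose treatment starts in some
        round. By \<open>step\<close> these can be extended forever with \<open>x\<close> outside
        all closures, which gives the branch \<open>m\<close> on which \<open>\<tau>\<close> misses
        \<open>x\<close>.\<close>
      define Q where "Q s \<longleftrightarrow> set s \<subseteq> ?O \<and> (\<exists>n. S n = (s, \<kappa> s, {}))" for s
      have "\<exists>m. Q s \<longrightarrow> m \<in> ?O \<and> x \<notin> C (s @ [m]) \<and> Q (s @ [m])" for s
      proof (cases "Q s")
        case True
        then obtain n where "S n = (s, \<kappa> s, {})" "set s \<subseteq> ?O"
          unfolding Q_def by blast
        then show ?thesis
          using step[of n s "\<kappa> s" "{}"] \<kappa>[of s] unfolding Q_def by auto
      qed blast
      then obtain g where g: "\<And>s. Q s \<Longrightarrow> g s \<in> ?O \<and> x \<notin> C (s @ [g s]) \<and> Q (s @ [g s])"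
        by metis
      obtain m where m: "\<And>n. m n = g (map m [0..<n])"
        using ex_history_recursion[of g] by blast
      have Q: "Q (map m [0..<n])" for n
      proof (induction n)
        case 0
        show ?case using S0 by (auto simp: Q_def)
      next
        case (Suc n)
        then show ?case using g[of "map m [0..<n]"] m[of n] by simp
      qed
      have mO: "m n \<in> ?O" for n
        using g[OF Q[of n]] m[of n] by simp
      have xC: "x \<notin> C (map m [0..<Suc n])" for n
        using g[OF Q[of n]] m[of n] by simp
      obtain n i where i: "i < f n" "x \<in> \<tau> (map m [0..<Suc n]) ! i"
        using x \<tau>_win[of m, OF mO] by blast
      have \<tau>m: "length (\<tau> (map m [0..<Suc n])) = f n" "set (\<tau> (map m [0..<Suc n])) \<subseteq> m n"
        using \<tau>[of "map m [0..<n]" "m n"] mO by auto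
      then have "x \<in> \<Union>(set (\<tau> (map m [0..<Suc n])))"
        using i nth_mem by (metis UnionI)
      moreover have "\<Union>(set (\<tau> (map m [0..<Suc n]))) \<subseteq> topspace X"
        using \<tau>m(2) mO[of n] by (auto simp: open_covers_def simp del: upt_Suc)
      ultimately have "x \<in> C (map m [0..<Suc n])"
        unfolding C_def using closure_of_subset by blast
      with xC show False
        by blast
    qed
  qed
  then have "winning_strategy_II (Rothberger_game X) \<rho>"
    using \<rho> by (simp add: winning_strategy_II_def Rothberger_game_def)
  then show ?thesis by blast
qed

theorem corollary2p3:
  fixes X :: "'a topology" and f :: "nat \<Rightarrow> nat"
  assumes "Hausdorff_space X"
    and "\<And>n. f n \<noteq> 0"
  shows "equivalent_games (Rothberger_game X) (f_Rothberger_game f X)"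
  unfolding equivalent_games_def
proof (intro conjI iffI; elim exE)
  fix \<sigma> assume "winning_strategy_I (Rothberger_game X) \<sigma>"
  then show "\<exists>\<sigma>. winning_strategy_I (f_Rothberger_game f X) \<sigma>"
    by (intro not_Rothberger_space_imp_winning_strategy_I[where f = f, OF _ assms(2)]
        winning_strategy_I_imp_not_Rothberger_space)
next
  fix \<sigma> assume "winning_strategy_I (f_Rothberger_game f X) \<sigma>"
  then show "\<exists>\<sigma>. winning_strategy_I (Rothberger_game X) \<sigma>"
    using assms(2) by (rule winning_strategy_I_f_Rothberger_imp_Rothberger)
next
  fix \<tau> assume "winning_strategy_II (Rothberger_game X) \<tau>"
  then show "\<exists>\<tau>. winning_strategy_II (f_Rothberger_game f X) \<tau>"
    using assms(2) by (rule winning_strategy_II_Rothberger_imp_f_Rothberger)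
next
  fix \<tau> assume "winning_strategy_II (f_Rothberger_game f X) \<tau>"
  with assms show "\<exists>\<tau>. winning_strategy_II (Rothberger_game X) \<tau>"
    by (rule winning_strategy_II_f_Rothberger_imp_Rothberger)
qed

end
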